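(* Let $\mathcal{N}=(\mathcal{G},\mathcal{V}_b,\nu,P,Q)$ be a generalized electrical network with $\mathcal{G}=(\mathcal{V},\mathcal{E})$, $e=|\mathcal{E}|$, and let $p_1,\dots,p_e$ and $q_1,\dots,q_e$ (the columns of $P$ and $Q$) be the coefficient vectors of its edges. If $$\dim\operatorname{span}\{p_1,\dots,p_e\}=\dim\operatorname{span}\{q_1,\dots,q_e\}=1,$$ then there exists a generalized electrical network $\hat{\mathcal{N}}=(\hat{\mathcal{G}},\mathcal{V}_b,\nu,\hat P,\hat Q)$, with the same $\nu$, whose graph $\hat{\mathcal{G}}=(\mathcal{V}_b,\hat{\mathcal{E}})$ has vertex set exactly $\mathcal{V}_b$ (so every vertex of $\hat{\mathcal{G}}$ is a boundary vertex), such that the terminal behaviors coincide: $\mathcal{B}_{\mathcal{N}}=\mathcal{B}_{\hat{\mathcal{N}}}$.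
   Context: Graphs. A directed graph $\mathcal{G}=(\mathcal{V},\mathcal{E})$ has a finite vertex set $\mathcal{V}=\{1,\dots,v\}$ and a finite edge set $\mathcal{E}\subseteq\mathcal{V}\times\mathcal{V}$, $\mathcal{E}=\{e_1,\dots,e_e\}$, with $i\neq j$ for each edge $(i,j)$. Its incidence matrix $B\in\mathbb{R}^{v\times e}$ is given, for $e_k=(i,j)$, by $B_{ik}=-1$, $B_{jk}=1$, and $B_{xk}=0$ for $x\notin\{i,j\}$. All graphs are assumed connected (edges may be traversed in either direction). Given a nonempty set $\mathcal{V}_b\subseteq\mathcal{V}$ of boundary vertices, put $\mathcal{V}_i=\mathcal{V}\setminus\mathcal{V}_b$ (internal vertices), and let $B_b$, $B_i$ be the submatrices of $B$ formed by the rows indexed by $\mathcal{V}_b$, $\mathcal{V}_i$ respectively. A graph with at least one boundary vertex is called open. Generalized electrical network. This is a tuple $\mathcal{N}=(\mathcal{G},\mathcal{V}_b,\nu,P,Q)$ where $\mathcal{G}$ is an open directed (connected) graph with boundary vertices $\mathcal{V}_b$, $\nu$ is a nonnegative integer, and $P=[p_1|\cdots|p_e]$, $Q=[q_1|\cdots|q_e]$ are real $(\nu+1)\times e$ matrices whose columns $p_k=(p_{k0},\dots,p_{k\nu})$, $q_k=(q_{k0},\dots,q_{k\nu})$, called coefficient vectors, have nonnegative entries and satisfy $p_k\neq 0$ and $q_k\neq 0$ for every $k$. Trajectories are smooth functions of time $t\in\mathbb{R}$: edge currents $I_1\in\mathcal{C}^\infty(\mathbb{R},\mathbb{R}^e)$,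 edge voltages $V^1\in\mathcal{C}^\infty(\mathbb{R},\mathbb{R}^e)$, boundary and internal vertex potentials $\psi^{0b}\in\mathcal{C}^\infty(\mathbb{R},\mathbb{R}^{|\mathcal{V}_b|})$, $\psi^{0i}\in\mathcal{C}^\infty(\mathbb{R},\mathbb{R}^{|\mathcal{V}_i|})$, and currents injected at boundary vertices $I_{0b}\in\mathcal{C}^\infty(\mathbb{R},\mathbb{R}^{|\mathcal{V}_b|})$. Terminal behavior. $\mathcal{B}_{\mathcal{N}}$ is the set of pairs $(\psi^{0b},I_{0b})$ of smooth trajectories for which there exist smooth $\psi^{0i}$, $I_1$, $V^1$ satisfying, for all $t\in\mathbb{R}$: (KCL) $B_iI_1=0$ and $B_bI_1=I_{0b}$; (KVL) $V^1=B_b^T\psi^{0b}+B_i^T\psi^{0i}$; (constitutive relations) $\sum_{j=0}^{\nu}p_{kj}\frac{d^j}{dt^j}I_{1,k}=\sum_{j=0}^{\nu}q_{kj}\frac{d^j}{dt^j}V^1_k$ for every edge $k\in\{1,\dots,e\}$, where $I_{1,k}$ and $V^1_k$ are the $k$-th components. When $\mathcal{V}_i=\emptyset$ the internal terms are absent. *)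

theory Defs
  imports
    "HOL-Analysis.Analysis"
    "Jordan_Normal_Form.DL_Rank"
    "Graph_Theory.Graph_Theory"
begin

definition smooth :: "(real \<Rightarrow> real) \<Rightarrow> bool" where
  "smooth f \<longleftrightarrow> (\<forall>n t. (deriv ^^ n) f differentiable (at t))"

text \<open>
  The space \<open>C\<^sup>\<infinity>(\<real>, \<real>\<^sup>A)\<close> for a finite index set \<open>A\<close>. A trajectory is given by its family of
  components, with the dummy value \<^const>\<open>undefined\<close> off \<open>A\<close>, so that two trajectories are equal
  iff their components with index in \<open>A\<close> are.
\<close>

definition trajectories :: "'i set \<Rightarrow> ('i \<Rightarrow> real \<Rightarrow> real) set" where
  "trajectories A = A \<rightarrow>\<^sub>E {f. smooth f}"

text \<open>
  The list \<open>net_edges\<close> is the enumeration \<open>e\<^sub>1, \<dots>, e\<^sub>e\<close> of the edge set; list positions, and hence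
  the columns of \<open>net_P\<close> and \<open>net_Q\<close>, are counted from \<open>0\<close>.
\<close>

record 'v network =
  net_graph :: "'v pair_pre_digraph"
  net_edges :: "('v \<times> 'v) list"
  net_boundary :: "'v set"
  net_order :: nat
  net_P :: "real mat"
  net_Q :: "real mat"

abbreviation net_internal :: "'v network \<Rightarrow> 'v set" where
  "net_internal N \<equiv> pverts (net_graph N) - net_boundary N"

abbreviation net_size :: "'v network \<Rightarrow> nat" where
  "net_size N \<equiv> length (net_edges N)"

text \<open>
  Since \<^const>\<open>pair_digraph\<close> takes its arcs to be ordered pairs, edges in opposite directions between
  the same two vertices are allowed, but no two edges with the same ends and the same direction.
  \<^const>\<open>Digraph_Component.connected\<close> is connectedness of the underlying undirected graph.
\<close>

definition generalized_network :: "'v network \<Rightarrow> bool" where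
  "generalized_network N \<longleftrightarrow>
     pair_digraph (net_graph N) \<and>
     Digraph_Component.connected (with_proj (net_graph N)) \<and>
     distinct (net_edges N) \<and> set (net_edges N) = parcs (net_graph N) \<and>
     net_boundary N \<subseteq> pverts (net_graph N) \<and> net_boundary N \<noteq> {} \<and>
     net_P N \<in> carrier_mat (net_order N + 1) (net_size N) \<and>
     net_Q N \<in> carrier_mat (net_order N + 1) (net_size N) \<and>
     (\<forall>k<net_size N.
        (\<forall>j\<le>net_order N. net_P N $$ (j, k) \<ge> 0 \<and> net_Q N $$ (j, k) \<ge> 0) \<and>
        col (net_P N) k \<noteq> 0\<^sub>v (net_order N + 1) \<and>
        col (net_Q N) k \<noteq> 0\<^sub>v (net_order N + 1))"

definition incidence :: "'v network \<Rightarrow> 'v \<Rightarrow> nat \<Rightarrow> real" where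
  "incidence N x k =
     (if x = fst (net_edges N ! k) then -1 else if x = snd (net_edges N ! k) then 1 else 0)"

definition terminal_behavior ::
    "'v network \<Rightarrow> (('v \<Rightarrow> real \<Rightarrow> real) \<times> ('v \<Rightarrow> real \<Rightarrow> real)) set" where
  "terminal_behavior N =
     {(\<psi>b, Ib).
        \<psi>b \<in> trajectories (net_boundary N) \<and> Ib \<in> trajectories (net_boundary N) \<and>
        (\<exists>\<psi>i \<in> trajectories (net_internal N).
         \<exists>I \<in> trajectories {..<net_size N}. \<exists>V \<in> trajectories {..<net_size N}. \<forall>t.
          (\<forall>x\<in>net_internal N. (\<Sum>k<net_size N. incidence N x k * I k t) = 0) \<and>
          (\<forall>x\<in>net_boundary N. (\<Sum>k<net_size N. incidence N x k * I k t) = Ib x t) \<and>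
          (\<forall>k<net_size N. V k t =
             (\<Sum>x\<in>net_boundary N. incidence N x k * \<psi>b x t) +
             (\<Sum>x\<in>net_internal N. incidence N x k * \<psi>i x t)) \<and>
          (\<forall>k<net_size N.
             (\<Sum>j\<le>net_order N. net_P N $$ (j, k) * (deriv ^^ j) (I k) t) =
             (\<Sum>j\<le>net_order N. net_Q N $$ (j, k) * (deriv ^^ j) (V k) t)))}"

definition (in vec_space) dim_span :: "'a vec set \<Rightarrow> nat" where
  "dim_span S = vectorspace.dim class_ring (span_vs S)"

end

theory Submission
  imports Defs
begin

text \<open>
  By the rank hypotheses and nonnegativity, \<open>p\<^sub>k = a\<^sub>k p\<close> and \<open>q\<^sub>k = b\<^sub>k q\<close> with \<open>a\<^sub>k, b\<^sub>k > 0\<close>, so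
  every constitutive relation reads \<open>p(D) I\<^sub>k = g\<^sub>k q(D) V\<^sub>k\<close> with conductance \<open>g\<^sub>k = b\<^sub>k / a\<^sub>k > 0\<close>.
  With \<open>L = B G B\<^sup>T\<close> the weighted Laplacian, the terminal behavior consists of the boundary
  trajectories with zero total current such that \<open>L q(D) \<phi> = p(D) J\<close> for some extension \<open>\<phi>\<close> of the
  boundary potentials, where \<open>J\<close> is extended by zero to the internal vertices. Edge currents are
  recovered without solving a differential equation, as \<open>I = G B\<^sup>T u\<close> with \<open>L u = J\<close>. Eliminating
  one internal vertex at a time (star-mesh transformation) turns this description into that of a
  connected weighted graph on the boundary vertices, which is the graph of the required network.
\<close>

subsection \<open>Weighted Laplacians and the star-mesh transformation\<close>

definition laplacian :: "'v set \<Rightarrow> ('v \<Rightarrow> 'v \<Rightarrow> real) \<Rightarrow> ('v \<Rightarrow> real) \<Rightarrow> 'v \<Rightarrow> real" where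
  "laplacian V w u x = (\<Sum>y\<in>V. w x y * (u x - u y))"

text \<open>
  Diagonal weights may be arbitrary because the Laplacian ignores them; \<open>star_mesh\<close> creates
  such loops.
\<close>

definition weighted_graph :: "'v set \<Rightarrow> ('v \<Rightarrow> 'v \<Rightarrow> real) \<Rightarrow> bool" where
  "weighted_graph V w \<longleftrightarrow> finite V \<and> V \<noteq> {} \<and>
     (\<forall>x\<in>V. \<forall>y\<in>V. w x y = w y x \<and> w x y \<ge> 0) \<and>
     (\<forall>S. S \<subseteq> V \<and> S \<noteq> {} \<and> S \<noteq> V \<longrightarrow> (\<exists>x\<in>S. \<exists>y\<in>V - S. w x y > 0))"

text \<open>Kron reduction: for distinct \<open>x\<close> and \<open>y\<close> these are the edge
  weights of the Schur complement of the Laplacian with respect to \<open>z\<close>, whose diagonal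
  entry at \<open>z\<close> is the sum in the denominator.\<close>

definition star_mesh :: "'v set \<Rightarrow> 'v \<Rightarrow> ('v \<Rightarrow> 'v \<Rightarrow> real) \<Rightarrow> 'v \<Rightarrow> 'v \<Rightarrow> real" where
  "star_mesh V z w x y = w x y + w x z * w z y / (\<Sum>v\<in>V - {z}. w z v)"

text \<open>Gaussian elimination of the unknown \<open>u z\<close>: the equation at \<open>z\<close>
  is solved for \<open>u z\<close> and substituted into the others. This forwards the source
  \<open>b z\<close> to the remaining vertices, in proportion to their weights towards
  \<open>z\<close>.\<close>

lemma laplacian_star_mesh:
  assumes "finite V" "z \<in> V" and W: "(\<Sum>y\<in>V - {z}. w z y) \<noteq> 0"
  shows "(\<forall>x\<in>V. laplacian V w u x = b x) \<longleftrightarrow>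
    u z = (b z + (\<Sum>y\<in>V - {z}. w z y * u y)) / (\<Sum>y\<in>V - {z}. w z y) \<and>
    (\<forall>x\<in>V - {z}. laplacian (V - {z}) (star_mesh V z w) u x
       = b x + w x z * b z / (\<Sum>y\<in>V - {z}. w z y))"
proof -
  define W where "W = (\<Sum>y\<in>V - {z}. w z y)"
  define S where "S = (\<Sum>y\<in>V - {z}. w z y * u y)"
  have W0: "W \<noteq> 0" using W by (simp add: W_def)
  have split: "laplacian V w u x = w x z * (u x - u z) + laplacian (V - {z}) w u x" for x
    unfolding laplacian_def using assms by (simp add: sum.remove)
  have "laplacian (V - {z}) w u z = W * u z - S"
    by (simp add: laplacian_def W_def S_def algebra_simps sum_subtractf sum_distrib_left)
  then have z: "laplacian V w u z = b z \<longleftrightarrow> u z = (b z + S) / W"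
    using W0 split[of z] by (auto simp: field_simps)
  have mesh: "laplacian (V - {z}) (star_mesh V z w) u x
      = laplacian (V - {z}) w u x + w x z / W * (W * u x - S)" for x
  proof -
    have "laplacian (V - {z}) (star_mesh V z w) u x
        = (\<Sum>y\<in>V - {z}. w x y * (u x - u y) + w x z / W * (w z y * u x - w z y * u y))"
      unfolding laplacian_def star_mesh_def W_def[symmetric]
      by (intro sum.cong) (auto simp: algebra_simps diff_divide_distrib)
    also have "\<dots> = laplacian (V - {z}) w u x + w x z / W * (W * u x - S)"
      unfolding sum.distrib sum_distrib_left[symmetric] sum_subtractf sum_distrib_right[symmetric]
      by (simp add: laplacian_def W_def S_def)
    finally show ?thesis .
  qed
  \<comment> \<open>The equation at \<open>z\<close> says \<open>S = W * u z - b z\<close>, so the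
    correction in \<open>mesh\<close> is the lost edge term \<open>w x z * (u x - u z)\<close> plus
    the forwarded source.\<close>
  have rest: "laplacian V w u x = b x \<longleftrightarrow>
      laplacian (V - {z}) (star_mesh V z w) u x = b x + w x z * b z / W"
    if "u z = (b z + S) / W" for x
  proof -
    have "W * u x - S = W * (u x - u z) + b z" using that W0 by (simp add: right_diff_distrib)
    then have "w x z / W * (W * u x - S) = w x z * (u x - u z) + w x z * b z / W"
      using W0 by (simp add: distrib_left)
    then show ?thesis unfolding split[of x] mesh[of x] by linarith
  qed
  show ?thesis
    unfolding W_def[symmetric] S_def[symmetric]
    using z rest assms(2) by (metis Diff_iff empty_iff insert_iff)
qed

lemma weighted_graph_degree_pos:
  assumes "weighted_graph V w" "z \<in> V" "V - {z} \<noteq> {}"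
  shows "(\<Sum>y\<in>V - {z}. w z y) > 0"
proof -
  have "\<exists>x\<in>{z}. \<exists>y\<in>V - {z}. w x y > 0"
    using assms unfolding weighted_graph_def by blast
  then obtain y where "y \<in> V - {z}" "w z y > 0" by auto
  then show ?thesis
    using assms by (intro sum_pos2[of _ y]) (auto simp: weighted_graph_def)
qed

text \<open>Connectedness survives: an edge from \<open>S\<close> to a vertex other than
  \<open>z\<close> keeps positive weight. If instead \<open>S\<close> is joined to \<open>z\<close>,
  some edge leaves \<open>insert z S\<close>; it starts either in \<open>S\<close> or at
  \<open>z\<close>, and in the latter case the two-step path through \<open>z\<close> becomes a mesh
  edge.\<close>

lemma weighted_graph_star_mesh:
  assumes G: "weighted_graph V w" and z: "z \<in> V" "V - {z} \<noteq> {}"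
  shows "weighted_graph (V - {z}) (star_mesh V z w)"
proof -
  define W where "W = (\<Sum>y\<in>V - {z}. w z y)"
  have W: "W > 0" using weighted_graph_degree_pos[OF assms] by (simp add: W_def)
  have sym: "\<And>x y. x \<in> V \<Longrightarrow> y \<in> V \<Longrightarrow> w x y = w y x"
    and nn: "\<And>x y. x \<in> V \<Longrightarrow> y \<in> V \<Longrightarrow> w x y \<ge> 0"
    and cut: "\<And>S. S \<subseteq> V \<Longrightarrow> S \<noteq> {} \<Longrightarrow> S \<noteq> V \<Longrightarrow> \<exists>x\<in>S. \<exists>y\<in>V - S. w x y > 0"
    using G unfolding weighted_graph_def by blast+
  have m: "star_mesh V z w x y = w x y + w x z * w z y / W" for x y
    by (simp add: star_mesh_def W_def)
  have direct: "star_mesh V z w x y > 0" if "x \<in> V" "y \<in> V" "w x y > 0" for x y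
    using that nn[of x z] nn[of z y] z W by (simp add: m add_pos_nonneg)
  have via: "star_mesh V z w x y > 0" if "x \<in> V" "y \<in> V" "w x z > 0" "w z y > 0" for x y
    using that nn[of x y] W by (simp add: m add_nonneg_pos)
  have "\<exists>x\<in>S. \<exists>y\<in>V - {z} - S. star_mesh V z w x y > 0"
    if S: "S \<subseteq> V - {z}" "S \<noteq> {}" "S \<noteq> V - {z}" for S
  proof -
    obtain x y where xy: "x \<in> S" "y \<in> V - S" "w x y > 0"
      using cut[of S] S z by blast
    show ?thesis
    proof (cases "y = z")
      case False
      then show ?thesis using xy S direct[of x y] by blast
    next
      case True
      obtain x' y' where xy': "x' \<in> insert z S" "y' \<in> V - insert z S" "w x' y' > 0"
        using cut[of "insert z S"] S z by blast
      show ?thesis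
      proof (cases "x' = z")
        case True
        then show ?thesis using xy' xy \<open>y = z\<close> S via[of x y'] by blast
      next
        case False
        then show ?thesis using xy' S direct[of x' y'] by blast
      qed
    qed
  qed
  moreover have "star_mesh V z w x y = star_mesh V z w y x \<and> star_mesh V z w x y \<ge> 0"
    if "x \<in> V - {z}" "y \<in> V - {z}" for x y
    using that z W sym[of x y] sym[of x z] sym[of z y] nn[of x y] nn[of x z] nn[of z y]
    by (simp add: m)
  ultimately show ?thesis
    using G z unfolding weighted_graph_def by blast
qed

text \<open>Existence and uniqueness up to a constant for the static network. Both claims pass
  through the elimination of one vertex, so they share an induction that bottoms out at a single
  vertex, where the Laplacian vanishes.\<close>

lemma laplacian_solvable_and_kernel:
  assumes "weighted_graph V w"
  shows "((\<Sum>x\<in>V. b x) = 0 \<longrightarrow> (\<exists>u. \<forall>x\<in>V. laplacian V w u x = b x)) \<and>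
    ((\<forall>x\<in>V. laplacian V w v x = 0) \<longrightarrow> (\<forall>x\<in>V. \<forall>y\<in>V. v x = v y))"
  using assms
proof (induction "card V" arbitrary: V w b)
  case 0
  then show ?case by (simp add: weighted_graph_def)
next
  case (Suc m)
  then obtain z where z: "z \<in> V" unfolding weighted_graph_def by blast
  have fin: "finite V" using Suc.prems by (simp add: weighted_graph_def)
  show ?case
  proof (cases "V - {z} = {}")
    case True
    then have "V = {z}" using z by blast
    then show ?thesis by (simp add: laplacian_def)
  next
    case False
    let ?W = "\<Sum>y\<in>V - {z}. w z y"
    have W: "?W > 0" using weighted_graph_degree_pos[OF Suc.prems z False] .
    note elim = laplacian_star_mesh[OF fin z, of w]
    have m: "m = card (V - {z})" using Suc.hyps(2) z fin by simp
    note IH = Suc.hyps(1)[OF m weighted_graph_star_mesh[OF Suc.prems z False]]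
    have "\<exists>u. \<forall>x\<in>V. laplacian V w u x = b x" if b: "(\<Sum>x\<in>V. b x) = 0"
    proof -
      \<comment> \<open>The source at \<open>z\<close> is spread over the other vertices; by
        symmetry of \<open>w\<close> the shares \<open>w x z / ?W\<close> add up to one, so the
        total stays zero.\<close>
      let ?b = "\<lambda>x. b x + w x z * b z / ?W"
      have "(\<Sum>x\<in>V - {z}. w x z) = ?W"
        using Suc.prems z by (intro sum.cong) (auto simp: weighted_graph_def)
      then have "(\<Sum>x\<in>V - {z}. w x z * b z / ?W) = b z"
        using W unfolding sum_divide_distrib[symmetric] sum_distrib_right[symmetric] by simp
      moreover have "(\<Sum>x\<in>V - {z}. b x) = - b z"
        using b z fin by (simp add: sum.remove)
      ultimately have "(\<Sum>x\<in>V - {z}. ?b x) = 0"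
        by (simp add: sum.distrib)
      then obtain u where u: "\<forall>x\<in>V - {z}. laplacian (V - {z}) (star_mesh V z w) u x = ?b x"
        using IH[of ?b] by blast
      \<comment> \<open>The solution on \<open>V - {z}\<close> is extended by the value that the
        equation at \<open>z\<close> dictates.\<close>
      let ?u = "u(z := (b z + (\<Sum>y\<in>V - {z}. w z y * u y)) / ?W)"
      have "laplacian (V - {z}) (star_mesh V z w) ?u x
          = laplacian (V - {z}) (star_mesh V z w) u x" if "x \<in> V - {z}" for x
        using that unfolding laplacian_def by (intro sum.cong) auto
      moreover have "(\<Sum>y\<in>V - {z}. w z y * ?u y) = (\<Sum>y\<in>V - {z}. w z y * u y)"
        by (intro sum.cong) auto
      ultimately have "\<forall>x\<in>V. laplacian V w ?u x = b x"
        using elim[of ?u b] u W by simp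
      then show ?thesis by blast
    qed
    moreover have "\<forall>x\<in>V. \<forall>y\<in>V. v x = v y" if v: "\<forall>x\<in>V. laplacian V w v x = 0"
    proof -
      \<comment> \<open>Without a source, the potential at \<open>z\<close> is the weighted mean of
        the others, so it equals their common value.\<close>
      have vz: "v z = (\<Sum>y\<in>V - {z}. w z y * v y) / ?W"
        and "\<forall>x\<in>V - {z}. laplacian (V - {z}) (star_mesh V z w) v x = 0"
        using elim[of v "\<lambda>_. 0"] v W by auto
      then have const: "\<forall>x\<in>V - {z}. \<forall>y\<in>V - {z}. v x = v y"
        using IH[of b] by blast
      obtain c where c: "c \<in> V - {z}" using False by blast
      have vc: "v y = v c" if "y \<in> V - {z}" for y using const c that by blast
      have "(\<Sum>y\<in>V - {z}. w z y * v y) = (\<Sum>y\<in>V - {z}. w z y * v c)"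
        by (intro sum.cong refl arg_cong2[where f = times] vc)
      then have "v z = ?W * v c / ?W" unfolding vz sum_distrib_right by (rule arg_cong)
      also have "\<dots> = v c" using W by simp
      finally have "v x = v c" if "x \<in> V" for x using vc that by blast
      then show ?thesis by metis
    qed
    ultimately show ?thesis by blast
  qed
qed

subsection \<open>Constant-coefficient differential operators\<close>

definition diff_op :: "nat \<Rightarrow> (nat \<Rightarrow> real) \<Rightarrow> (real \<Rightarrow> real) \<Rightarrow> real \<Rightarrow> real" where
  "diff_op n c f t = (\<Sum>j\<le>n. c j * (deriv ^^ j) f t)"

lemma smooth_has_derivative:
  "smooth f \<Longrightarrow> ((deriv ^^ n) f has_field_derivative (deriv ^^ Suc n) f t) (at t)"
  by (simp add: smooth_def DERIV_deriv_iff_real_differentiable)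

lemma iterated_deriv_sum:
  assumes "\<And>i. i \<in> A \<Longrightarrow> smooth (f i)"
  shows "(deriv ^^ n) (\<lambda>t. \<Sum>i\<in>A. c i * f i t) = (\<lambda>t. \<Sum>i\<in>A. c i * (deriv ^^ n) (f i) t)"
proof (induction n)
  case (Suc n)
  have "((\<lambda>t. \<Sum>i\<in>A. c i * (deriv ^^ n) (f i) t) has_field_derivative
      (\<Sum>i\<in>A. c i * (deriv ^^ Suc n) (f i) t)) (at t)" for t
    by (intro DERIV_sum DERIV_cmult smooth_has_derivative assms)
  then have "deriv (\<lambda>t. \<Sum>i\<in>A. c i * (deriv ^^ n) (f i) t)
      = (\<lambda>t. \<Sum>i\<in>A. c i * (deriv ^^ Suc n) (f i) t)"
    by (intro ext DERIV_imp_deriv)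
  then show ?case using Suc by simp
qed simp

lemma smooth_sum:
  assumes "\<And>i. i \<in> A \<Longrightarrow> smooth (f i)"
  shows "smooth (\<lambda>t. \<Sum>i\<in>A. c i * f i t)"
proof -
  have "((\<lambda>t. \<Sum>i\<in>A. c i * (deriv ^^ n) (f i) t) has_field_derivative
      (\<Sum>i\<in>A. c i * (deriv ^^ Suc n) (f i) t)) (at t)" for n t
    by (intro DERIV_sum DERIV_cmult smooth_has_derivative assms)
  then have "(\<lambda>t. \<Sum>i\<in>A. c i * (deriv ^^ n) (f i) t) differentiable at t" for n t
    unfolding real_differentiable_def by blast
  then show ?thesis
    by (simp add: smooth_def iterated_deriv_sum[OF assms])
qed

lemma diff_op_sum:
  assumes "\<And>i. i \<in> A \<Longrightarrow> smooth (f i)"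
  shows "diff_op n p (\<lambda>t. \<Sum>i\<in>A. c i * f i t) t = (\<Sum>i\<in>A. c i * diff_op n p (f i) t)"
proof -
  have "diff_op n p (\<lambda>t. \<Sum>i\<in>A. c i * f i t) t
      = (\<Sum>j\<le>n. \<Sum>i\<in>A. p j * (c i * (deriv ^^ j) (f i) t))"
    by (simp add: diff_op_def iterated_deriv_sum[OF assms] sum_distrib_left)
  also have "\<dots> = (\<Sum>i\<in>A. \<Sum>j\<le>n. p j * (c i * (deriv ^^ j) (f i) t))"
    by (rule sum.swap)
  also have "\<dots> = (\<Sum>i\<in>A. c i * diff_op n p (f i) t)"
    by (simp add: diff_op_def sum_distrib_left mult.left_commute)
  finally show ?thesis .
qed

lemma diff_op_zero: "diff_op n p (\<lambda>_. 0) t = 0"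
  using diff_op_sum[of "{}" "\<lambda>_ _. 0" n p "\<lambda>_. 0" t] by simp

text \<open>A difference is a sum indexed by \<open>bool\<close> with coefficients 1 and -1, so
  linearity over finite sums covers it.\<close>

lemma diff_op_minus:
  assumes "smooth f" "smooth g"
  shows "diff_op n p (\<lambda>t. f t - g t) t = diff_op n p f t - diff_op n p g t"
  using diff_op_sum[of "UNIV :: bool set" "\<lambda>b. if b then f else g" n p "\<lambda>b. if b then 1 else -1" t]
    assms by (simp add: UNIV_bool)

lemma smooth_minus: "smooth f \<Longrightarrow> smooth g \<Longrightarrow> smooth (\<lambda>t. f t - g t)"
  using smooth_sum[of "UNIV :: bool set" "\<lambda>b. if b then f else g" "\<lambda>b. if b then 1 else -1"]
  by (simp add: UNIV_bool)

lemma trajectories_smooth: "f \<in> trajectories A \<Longrightarrow> x \<in> A \<Longrightarrow> smooth (f x)"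
  by (auto simp: trajectories_def)

lemma restrict_trajectories: "(\<And>x. x \<in> A \<Longrightarrow> smooth (f x)) \<Longrightarrow> restrict f A \<in> trajectories A"
  by (auto simp: trajectories_def)

subsection \<open>Behaviors described by a Laplacian\<close>

text \<open>The zero total current is a separate clause: for symmetric \<open>w\<close>, adding up
  the Laplacian equations only yields that \<open>p(D)\<close> annihilates the total, which in
  general admits nonzero totals.\<close>

definition laplacian_behavior ::
    "'v set \<Rightarrow> 'v set \<Rightarrow> nat \<Rightarrow> (nat \<Rightarrow> real) \<Rightarrow> (nat \<Rightarrow> real) \<Rightarrow> ('v \<Rightarrow> 'v \<Rightarrow> real) \<Rightarrow>
     (('v \<Rightarrow> real \<Rightarrow> real) \<times> ('v \<Rightarrow> real \<Rightarrow> real)) set" where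
  "laplacian_behavior V B n p q w =
     {(\<psi>, J). \<psi> \<in> trajectories B \<and> J \<in> trajectories B \<and> (\<forall>t. (\<Sum>x\<in>B. J x t) = 0) \<and>
        (\<exists>\<phi>. (\<forall>x\<in>V. smooth (\<phi> x)) \<and> (\<forall>x\<in>B. \<phi> x = \<psi> x) \<and>
          (\<forall>t. \<forall>x\<in>V. laplacian V w (\<lambda>y. diff_op n q (\<phi> y) t) x
             = (if x \<in> B then diff_op n p (J x) t else 0)))}"

text \<open>No current is injected at \<open>z\<close>, so elimination leaves the right-hand sides
  unchanged. What remains is to meet the equation at \<open>z\<close>, which constrains only
  \<open>q(D)\<close> of the potential there.\<close>

lemma laplacian_behavior_star_mesh:
  assumes G: "weighted_graph V w" and B: "B \<subseteq> V" and z: "z \<in> V - B" "V - {z} \<noteq> {}"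
  shows "laplacian_behavior V B n p q w = laplacian_behavior (V - {z}) B n p q (star_mesh V z w)"
proof -
  let ?W = "\<Sum>y\<in>V - {z}. w z y"
  have W: "?W > 0" using weighted_graph_degree_pos[OF G _ z(2)] z by blast
  have fin: "finite V" using G by (simp add: weighted_graph_def)
  define D where "D \<phi> t y = diff_op n q (\<phi> y) t" for \<phi> :: "'a \<Rightarrow> real \<Rightarrow> real" and t y
  define b where "b J t x = (if x \<in> B then diff_op n p (J x) t else 0)"
    for J :: "'a \<Rightarrow> real \<Rightarrow> real" and t x
  have bz: "b J t z = 0" for J t using z by (simp add: b_def)
  have elim: "(\<forall>x\<in>V. laplacian V w (D \<phi> t) x = b J t x) \<longleftrightarrow>
      D \<phi> t z = (\<Sum>y\<in>V - {z}. w z y * D \<phi> t y) / ?W \<and>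
      (\<forall>x\<in>V - {z}. laplacian (V - {z}) (star_mesh V z w) (D \<phi> t) x = b J t x)" for \<phi> J t
    using laplacian_star_mesh[OF fin, of z w "D \<phi> t" "b J t"] z W by (simp add: bz)
  have "(\<exists>\<phi>. (\<forall>x\<in>V. smooth (\<phi> x)) \<and> (\<forall>x\<in>B. \<phi> x = \<psi> x) \<and>
          (\<forall>t. \<forall>x\<in>V. laplacian V w (D \<phi> t) x = b J t x)) \<longleftrightarrow>
      (\<exists>\<phi>. (\<forall>x\<in>V - {z}. smooth (\<phi> x)) \<and> (\<forall>x\<in>B. \<phi> x = \<psi> x) \<and>
          (\<forall>t. \<forall>x\<in>V - {z}. laplacian (V - {z}) (star_mesh V z w) (D \<phi> t) x = b J t x))"
    (is "?l \<longleftrightarrow> ?r") for \<psi> J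
  proof
    assume ?l
    then show ?r using elim by blast
  next
    assume ?r
    then obtain \<phi> where sm: "\<forall>x\<in>V - {z}. smooth (\<phi> x)" and \<psi>: "\<forall>x\<in>B. \<phi> x = \<psi> x"
      and lap: "\<And>t. \<forall>x\<in>V - {z}. laplacian (V - {z}) (star_mesh V z w) (D \<phi> t) x = b J t x"
      by blast
    \<comment> \<open>Taking the weighted mean of the potentials themselves satisfies that equation
      without solving a differential equation, since \<open>q(D)\<close> commutes with constant
      linear combinations.\<close>
    define \<phi>' where "\<phi>' = \<phi>(z := (\<lambda>t. \<Sum>y\<in>V - {z}. (w z y / ?W) * \<phi> y t))"
    have "smooth (\<phi>' z)"
      using sm smooth_sum[of "V - {z}" \<phi> "\<lambda>y. w z y / ?W"] by (simp add: \<phi>'_def)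
    then have 1: "\<forall>x\<in>V. smooth (\<phi>' x)" using sm by (simp add: \<phi>'_def)
    have 2: "\<forall>x\<in>B. \<phi>' x = \<psi> x" using \<psi> z by (auto simp: \<phi>'_def)
    have other: "D \<phi>' t y = D \<phi> t y" if "y \<in> V - {z}" for y t
      using that by (simp add: D_def \<phi>'_def)
    have "D \<phi>' t z = (\<Sum>y\<in>V - {z}. (w z y / ?W) * D \<phi> t y)" for t
      using sm diff_op_sum[of "V - {z}" \<phi> n q "\<lambda>y. w z y / ?W" t] by (simp add: D_def \<phi>'_def)
    also have "(\<Sum>y\<in>V - {z}. (w z y / ?W) * D \<phi> t y)
        = (\<Sum>y\<in>V - {z}. w z y * D \<phi>' t y) / ?W" for t
      unfolding sum_divide_distrib by (intro sum.cong) (auto simp: other)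
    finally have at_z: "D \<phi>' t z = (\<Sum>y\<in>V - {z}. w z y * D \<phi>' t y) / ?W" for t .
    have "laplacian (V - {z}) (star_mesh V z w) (D \<phi>' t) x
        = laplacian (V - {z}) (star_mesh V z w) (D \<phi> t) x" if "x \<in> V - {z}" for x t
      unfolding laplacian_def using that by (intro sum.cong) (auto simp: other)
    then have "\<forall>x\<in>V. laplacian V w (D \<phi>' t) x = b J t x" for t
      using elim[of \<phi>' t J] at_z[of t] lap[of t] by simp
    then show ?l using 1 2 by blast
  qed
  then show ?thesis
    unfolding laplacian_behavior_def D_def b_def by simp
qed

lemma laplacian_behavior_boundary:
  assumes "weighted_graph V w" "B \<subseteq> V" "B \<noteq> {}"
  shows "\<exists>w'. weighted_graph B w' \<and>
    laplacian_behavior V B n p q w = laplacian_behavior B B n p q w'"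
  using assms
proof (induction "card (V - B)" arbitrary: V w)
  case 0
  then have "V = B" by (auto simp: weighted_graph_def)
  then show ?case using 0 by blast
next
  case (Suc m)
  then obtain z where z: "z \<in> V - B" by (metis card.empty ex_in_conv nat.distinct(1))
  then have ne: "V - {z} \<noteq> {}" "B \<subseteq> V - {z}" using Suc.prems by auto
  have "V - {z} - B = (V - B) - {z}" by blast
  then have "m = card (V - {z} - B)"
    using Suc.hyps(2) z Suc.prems by (simp add: weighted_graph_def)
  then show ?case
    using Suc.hyps(1)[of "V - {z}" "star_mesh V z w"] weighted_graph_star_mesh[of V w z]
      laplacian_behavior_star_mesh[OF Suc.prems(1,2) z ne(1)] Suc.prems z ne
    by auto
qed

subsection \<open>Networks with proportional coefficient vectors\<close>

text \<open>Translates reachability into the cut condition of \<open>weighted_graph\<close>. A walk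
  that starts in \<open>S\<close> and ends outside must cross the cut; conversely, the set reachable
  from \<open>u\<close> has no crossing edge and so is everything.\<close>

lemma connected_iff_cut:
  assumes "pair_wf_digraph G"
  shows "Digraph_Component.connected (with_proj G) \<longleftrightarrow> pverts G \<noteq> {} \<and>
    (\<forall>S. S \<subseteq> pverts G \<and> S \<noteq> {} \<and> S \<noteq> pverts G \<longrightarrow>
      (\<exists>x\<in>S. \<exists>y\<in>pverts G - S. (x, y) \<in> parcs G \<or> (y, x) \<in> parcs G))"
proof -
  interpret pair_wf_digraph G by fact
  let ?H = "mk_symmetric (with_proj G)"
  have adj: "(x, y) \<in> parcs ?H \<longleftrightarrow> (x, y) \<in> parcs G \<or> (y, x) \<in> parcs G" for x y
    by (auto simp: mk_symmetric_def intro: bexI[of _ "(x, y)"] bexI[of _ "(y, x)"])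
  have verts: "pverts ?H = pverts G" by (simp add: mk_symmetric_def)
  show ?thesis
  proof (intro iffI conjI allI impI)
    assume "Digraph_Component.connected (with_proj G)"
    then show "pverts G \<noteq> {}"
      by (simp add: Digraph_Component.connected_def strongly_connected_def verts)
  next
    fix S assume conn: "Digraph_Component.connected (with_proj G)"
      and S: "S \<subseteq> pverts G \<and> S \<noteq> {} \<and> S \<noteq> pverts G"
    then obtain u v where uv: "u \<in> S" "v \<in> pverts G - S" by blast
    have reach: "u \<rightarrow>\<^sup>*\<^bsub>with_proj ?H\<^esub> v"
      using conn S uv unfolding Digraph_Component.connected_def strongly_connected_def
      by (auto simp: verts)
    show "\<exists>x\<in>S. \<exists>y\<in>pverts G - S. (x, y) \<in> parcs G \<or> (y, x) \<in> parcs G"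
    proof (rule ccontr)
      assume none: "\<not> ?thesis"
      from reach have "(u, v) \<in> rtrancl_on (pverts G) (parcs ?H)"
        by (simp add: reachable_def verts)
      then have "v \<in> S"
      proof (induction rule: rtrancl_on_induct)
        case base
        then show ?case using uv by simp
      next
        case (step x y)
        then have "(x, y) \<in> parcs G \<or> (y, x) \<in> parcs G" using adj by simp
        then show ?case using step none by blast
      qed
      then show False using uv by blast
    qed
  next
    assume cut: "pverts G \<noteq> {} \<and> (\<forall>S. S \<subseteq> pverts G \<and> S \<noteq> {} \<and> S \<noteq> pverts G \<longrightarrow>
      (\<exists>x\<in>S. \<exists>y\<in>pverts G - S. (x, y) \<in> parcs G \<or> (y, x) \<in> parcs G))"
    show "Digraph_Component.connected (with_proj G)"
      unfolding Digraph_Component.connected_def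
    proof
      show "verts (with_proj ?H) \<noteq> {}" using cut by (simp add: verts)
    next
      fix u v assume u: "u \<in> verts (with_proj ?H)" and v: "v \<in> verts (with_proj ?H)"
      define S where "S = {x \<in> pverts G. u \<rightarrow>\<^sup>*\<^bsub>with_proj ?H\<^esub> x}"
      have "u \<in> S" using u by (simp add: S_def verts reachable_def)
      have "S = pverts G"
      proof (rule ccontr)
        assume "S \<noteq> pverts G"
        moreover have "S \<subseteq> pverts G" by (auto simp: S_def)
        ultimately obtain x y where xy: "x \<in> S" "y \<in> pverts G - S" "(x, y) \<in> parcs ?H"
          using cut \<open>u \<in> S\<close> unfolding adj by blast
        then have "u \<rightarrow>\<^sup>*\<^bsub>with_proj ?H\<^esub> y"
          unfolding S_def reachable_def
          by (auto simp: verts intro: rtrancl_on_into_rtrancl_on)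
        then show False using xy by (simp add: S_def)
      qed
      then show "u \<rightarrow>\<^sup>*\<^bsub>with_proj ?H\<^esub> v" using v by (auto simp: S_def verts)
    qed
  qed
qed

section \<open>Incidence matrix and Laplacian of a network\<close>

text \<open>Antiparallel edges between the same vertices are possible; they act in parallel, so
  their conductances add.\<close>

definition conductance :: "('v \<times> 'v) list \<Rightarrow> (nat \<Rightarrow> real) \<Rightarrow> 'v \<Rightarrow> 'v \<Rightarrow> real" where
  "conductance es g x y =
     (\<Sum>k<length es. if es ! k = (x, y) \<or> es ! k = (y, x) then g k else 0)"

lemma generalized_network_edge:
  assumes "generalized_network N" "k < net_size N"
  shows "fst (net_edges N ! k) \<in> pverts (net_graph N)"
    "snd (net_edges N ! k) \<in> pverts (net_graph N)"
    "fst (net_edges N ! k) \<noteq> snd (net_edges N ! k)"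
proof -
  interpret pair_digraph "net_graph N"
    using assms by (simp add: generalized_network_def)
  have "net_edges N ! k \<in> parcs (net_graph N)"
    using assms nth_mem unfolding generalized_network_def by blast
  then show "fst (net_edges N ! k) \<in> pverts (net_graph N)"
    "snd (net_edges N ! k) \<in> pverts (net_graph N)"
    "fst (net_edges N ! k) \<noteq> snd (net_edges N ! k)"
    using arc_fst_in_verts arc_snd_in_verts pair_no_loops by auto
qed

lemma generalized_network_finite: "generalized_network N \<Longrightarrow> finite (pverts (net_graph N))"
  by (simp add: generalized_network_def pair_digraph_def pair_fin_digraph_def
      pair_fin_digraph_axioms_def)

lemma incidence_transpose:
  assumes "generalized_network N" "k < net_size N"
  shows "(\<Sum>x\<in>pverts (net_graph N). incidence N x k * u x)
    = u (snd (net_edges N ! k)) - u (fst (net_edges N ! k))"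
proof -
  let ?V = "pverts (net_graph N)"
  note e = generalized_network_edge[OF assms]
  have "(\<Sum>x\<in>?V. incidence N x k * u x)
      = (\<Sum>x\<in>?V. (if x = snd (net_edges N ! k) then u x else 0)
          - (if x = fst (net_edges N ! k) then u x else 0))"
    using e(3) by (intro sum.cong) (auto simp: incidence_def)
  also have "\<dots> = u (snd (net_edges N ! k)) - u (fst (net_edges N ! k))"
    using e generalized_network_finite[OF assms(1)] by (simp add: sum_subtractf)
  finally show ?thesis .
qed

text \<open>The factorization \<open>L = B G B^T\<close>, obtained by exchanging the sums over
  neighbours and edges: an edge contributes only at its two ends.\<close>

lemma laplacian_conductance:
  assumes N: "generalized_network N" and x: "x \<in> pverts (net_graph N)"
  shows "laplacian (pverts (net_graph N)) (conductance (net_edges N) g) u x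
    = (\<Sum>k<net_size N. incidence N x k *
        (g k * (u (snd (net_edges N ! k)) - u (fst (net_edges N ! k)))))"
proof -
  let ?V = "pverts (net_graph N)"
  let ?e = "\<lambda>k. net_edges N ! k"
  have "laplacian ?V (conductance (net_edges N) g) u x
      = (\<Sum>k<net_size N. \<Sum>y\<in>?V.
          if ?e k = (x, y) \<or> ?e k = (y, x) then g k * (u x - u y) else 0)"
    unfolding laplacian_def conductance_def sum_distrib_right
    by (subst sum.swap) (auto intro!: sum.cong)
  also have "\<dots> = (\<Sum>k<net_size N. incidence N x k * (g k * (u (snd (?e k)) - u (fst (?e k)))))"
  proof (rule sum.cong[OF refl])
    fix k assume "k \<in> {..<net_size N}"
    then have e: "fst (?e k) \<in> ?V" "snd (?e k) \<in> ?V" "fst (?e k) \<noteq> snd (?e k)"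
      using generalized_network_edge[OF N] by auto
    obtain i j where ij: "?e k = (i, j)" by (cases "?e k")
    \<comment> \<open>For an edge incident with \<open>x\<close>, the only relevant \<open>y\<close>
      is its other end; the inner condition discards all other edges.\<close>
    have "(\<Sum>y\<in>?V. if ?e k = (x, y) \<or> ?e k = (y, x) then g k * (u x - u y) else 0)
        = (\<Sum>y\<in>?V. if y = (if x = i then j else i) then
             (if x = i \<or> x = j then g k * (u x - u y) else 0) else 0)"
      using e by (intro sum.cong) (auto simp: ij)
    also have "\<dots> = incidence N x k * (g k * (u (snd (?e k)) - u (fst (?e k))))"
      using e generalized_network_finite[OF N]
      by (simp add: sum.delta) (auto simp: ij incidence_def algebra_simps)
    finally show "(\<Sum>y\<in>?V. if ?e k = (x, y) \<or> ?e k = (y, x) then g k * (u x - u y) else 0)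
      = incidence N x k * (g k * (u (snd (?e k)) - u (fst (?e k))))" .
  qed
  finally show ?thesis .
qed

lemma weighted_graph_conductance:
  assumes N: "generalized_network N" and g: "\<And>k. k < net_size N \<Longrightarrow> g k > 0"
  shows "weighted_graph (pverts (net_graph N)) (conductance (net_edges N) g)"
proof -
  let ?V = "pverts (net_graph N)" and ?w = "conductance (net_edges N) g"
  interpret pair_digraph "net_graph N"
    using N by (simp add: generalized_network_def)
  have pos: "?w x y > 0" if xy: "(x, y) \<in> parcs (net_graph N) \<or> (y, x) \<in> parcs (net_graph N)" for x y
  proof -
    have "(x, y) \<in> set (net_edges N) \<or> (y, x) \<in> set (net_edges N)"
      using N xy by (simp add: generalized_network_def)
    then obtain k where "k < net_size N" "net_edges N ! k = (x, y) \<or> net_edges N ! k = (y, x)"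
      by (auto simp: in_set_conv_nth)
    then show ?thesis unfolding conductance_def
      using g by (intro sum_pos2[of _ k]) (auto intro: less_imp_le)
  qed
  have nn: "?w x y \<ge> 0" for x y
    unfolding conductance_def using g by (intro sum_nonneg) (auto intro: less_imp_le)
  have sym: "?w x y = ?w y x" for x y
    unfolding conductance_def by (intro sum.cong) auto
  have "?V \<noteq> {} \<and> (\<forall>S. S \<subseteq> ?V \<and> S \<noteq> {} \<and> S \<noteq> ?V \<longrightarrow> (\<exists>x\<in>S. \<exists>y\<in>?V - S.
      (x, y) \<in> parcs (net_graph N) \<or> (y, x) \<in> parcs (net_graph N)))"
    using N connected_iff_cut[OF pair_wf_digraph_axioms] by (simp add: generalized_network_def)
  then show ?thesis
    using nn sym pair_finite_verts pos unfolding weighted_graph_def by meson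
qed

text \<open>From left to right, \<open>p(D)\<close> is applied to the current law and the
  constitutive relations are inserted. From right to left, solving those relations for the currents
  would leave homogeneous solutions to be matched with the current law. Instead the currents are
  built from \<open>J\<close> so that the current law holds identically, and the constitutive
  relations follow from uniqueness up to constants.\<close>

lemma terminal_behavior_eq_laplacian_behavior:
  assumes N: "generalized_network N"
    and P: "\<forall>j\<le>net_order N. \<forall>k<net_size N. net_P N $$ (j, k) = a k * p j"
    and Q: "\<forall>j\<le>net_order N. \<forall>k<net_size N. net_Q N $$ (j, k) = b k * q j"
    and a: "\<forall>k<net_size N. a k > 0" and b: "\<forall>k<net_size N. b k > 0"
  shows "terminal_behavior N = laplacian_behavior (pverts (net_graph N)) (net_boundary N)
    (net_order N) p q (conductance (net_edges N) (\<lambda>k. b k / a k))"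
proof -
  let ?V = "pverts (net_graph N)" and ?B = "net_boundary N" and ?n = "net_order N"
  let ?hd = "\<lambda>k. snd (net_edges N ! k)" and ?tl = "\<lambda>k. fst (net_edges N ! k)"
  define g where "g k = b k / a k" for k
  let ?w = "conductance (net_edges N) g"
  have g: "g k > 0" if "k < net_size N" for k using a b that by (simp add: g_def)
  have G: "weighted_graph ?V ?w" using weighted_graph_conductance[OF N g] .
  have fin: "finite ?V" using generalized_network_finite[OF N] .
  have BV: "?B \<subseteq> ?V" "?B \<noteq> {}" using N by (auto simp: generalized_network_def)
  have bsum: "(\<Sum>x\<in>?B. f x) = (\<Sum>x\<in>?V. if x \<in> ?B then f x else 0)" for f :: "'a \<Rightarrow> real"
    using fin BV by (intro sum.mono_neutral_cong_left) auto
  have edge: "?hd k \<in> ?V" "?tl k \<in> ?V" if "k < net_size N" for k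
    using generalized_network_edge[OF N that] by auto
  have constitutive: "(\<Sum>j\<le>?n. net_P N $$ (j, k) * (deriv ^^ j) f t)
        = (\<Sum>j\<le>?n. net_Q N $$ (j, k) * (deriv ^^ j) h t) \<longleftrightarrow>
      diff_op ?n p f t = g k * diff_op ?n q h t" if "k < net_size N" for k f h t
  proof -
    have "(\<Sum>j\<le>?n. net_P N $$ (j, k) * (deriv ^^ j) f t) = a k * diff_op ?n p f t"
      "(\<Sum>j\<le>?n. net_Q N $$ (j, k) * (deriv ^^ j) h t) = b k * diff_op ?n q h t"
      using P Q that by (auto simp: diff_op_def sum_distrib_left mult.assoc intro!: sum.cong)
    then show ?thesis using a[rule_format, OF that] by (simp add: g_def field_simps)
  qed
  have "(\<psi>, J) \<in> laplacian_behavior ?V ?B ?n p q ?w"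
    if tb: "(\<psi>, J) \<in> terminal_behavior N" for \<psi> J
  proof -
    obtain \<psi>i I U where tr: "\<psi> \<in> trajectories ?B" "J \<in> trajectories ?B"
        "\<psi>i \<in> trajectories (?V - ?B)" "I \<in> trajectories {..<net_size N}"
      and eqs: "\<forall>t. (\<forall>x\<in>?V - ?B. (\<Sum>k<net_size N. incidence N x k * I k t) = 0) \<and>
        (\<forall>x\<in>?B. (\<Sum>k<net_size N. incidence N x k * I k t) = J x t) \<and>
        (\<forall>k<net_size N. U k t = (\<Sum>x\<in>?B. incidence N x k * \<psi> x t)
            + (\<Sum>x\<in>?V - ?B. incidence N x k * \<psi>i x t)) \<and>
        (\<forall>k<net_size N. (\<Sum>j\<le>?n. net_P N $$ (j, k) * (deriv ^^ j) (I k) t)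
          = (\<Sum>j\<le>?n. net_Q N $$ (j, k) * (deriv ^^ j) (U k) t))"
      using tb unfolding terminal_behavior_def by blast
    have int: "\<And>t x. x \<in> ?V - ?B \<Longrightarrow> (\<Sum>k<net_size N. incidence N x k * I k t) = 0"
      and bnd: "\<And>t x. x \<in> ?B \<Longrightarrow> (\<Sum>k<net_size N. incidence N x k * I k t) = J x t"
      and U: "\<And>t k. k < net_size N \<Longrightarrow> U k t = (\<Sum>x\<in>?B. incidence N x k * \<psi> x t)
            + (\<Sum>x\<in>?V - ?B. incidence N x k * \<psi>i x t)"
      and con: "\<And>t k. k < net_size N \<Longrightarrow>
          (\<Sum>j\<le>?n. net_P N $$ (j, k) * (deriv ^^ j) (I k) t)
          = (\<Sum>j\<le>?n. net_Q N $$ (j, k) * (deriv ^^ j) (U k) t)"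
      using eqs by blast+
    define \<phi> where "\<phi> x = (if x \<in> ?B then \<psi> x else \<psi>i x)" for x
    have sm: "smooth (\<phi> x)" if "x \<in> ?V" for x
      using that tr trajectories_smooth[of _ _ x] by (auto simp: \<phi>_def)
    have smI: "smooth (I k)" if "k < net_size N" for k
      using that tr trajectories_smooth[of I _ k] by auto
    have "U k t = \<phi> (?hd k) t - \<phi> (?tl k) t" if k: "k < net_size N" for k t
    proof -
      have "(\<Sum>x\<in>?B. incidence N x k * \<phi> x t) = (\<Sum>x\<in>?B. incidence N x k * \<psi> x t)"
        by (simp add: \<phi>_def)
      moreover have "(\<Sum>x\<in>?V - ?B. incidence N x k * \<phi> x t)
          = (\<Sum>x\<in>?V - ?B. incidence N x k * \<psi>i x t)"
        by (intro sum.cong) (auto simp: \<phi>_def)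
      ultimately have "U k t = (\<Sum>x\<in>?V. incidence N x k * \<phi> x t)"
        unfolding U[OF k] using sum.subset_diff[OF BV(1) fin, of "\<lambda>x. incidence N x k * \<phi> x t"]
        by simp
      then show ?thesis using incidence_transpose[OF N k] by simp
    qed
    \<comment> \<open>An equality of functions is required, because the constitutive relation
      differentiates \<open>U k\<close>.\<close>
    then have Ueq: "U k = (\<lambda>t. \<phi> (?hd k) t - \<phi> (?tl k) t)" if "k < net_size N" for k
      using that by blast
    have pI: "diff_op ?n p (I k) t
        = g k * (diff_op ?n q (\<phi> (?hd k)) t - diff_op ?n q (\<phi> (?tl k)) t)"
      if "k < net_size N" for k t
      using con[OF that] constitutive[OF that] diff_op_minus[OF sm sm] edge that
      by (simp add: Ueq)
    have "laplacian ?V ?w (\<lambda>y. diff_op ?n q (\<phi> y) t) x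
        = (if x \<in> ?B then diff_op ?n p (J x) t else 0)" if x: "x \<in> ?V" for x t
    proof -
      have "laplacian ?V ?w (\<lambda>y. diff_op ?n q (\<phi> y) t) x
          = (\<Sum>k<net_size N. incidence N x k * diff_op ?n p (I k) t)"
        unfolding laplacian_conductance[OF N x] using pI by (intro sum.cong) auto
      also have "\<dots> = diff_op ?n p (\<lambda>t. \<Sum>k<net_size N. incidence N x k * I k t) t"
        using smI by (intro diff_op_sum[symmetric]) auto
      also have "(\<lambda>t. \<Sum>k<net_size N. incidence N x k * I k t)
          = (if x \<in> ?B then J x else (\<lambda>_. 0))"
        using int bnd x by auto
      finally show ?thesis by (simp add: diff_op_zero)
    qed
    \<comment> \<open>Each column of the incidence matrix sums to zero, so the total vanishes itself
      and not merely after applying \<open>p(D)\<close>.\<close>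
    moreover have "(\<Sum>x\<in>?B. J x t) = 0" for t
    proof -
      have "(\<Sum>x\<in>?B. J x t) = (\<Sum>x\<in>?V. \<Sum>k<net_size N. incidence N x k * I k t)"
        unfolding bsum using int bnd by (intro sum.cong) auto
      also have "\<dots> = (\<Sum>k<net_size N. (\<Sum>x\<in>?V. incidence N x k * 1) * I k t)"
        by (subst sum.swap) (simp add: sum_distrib_right)
      also have "\<dots> = 0"
        using incidence_transpose[OF N, of _ "\<lambda>_. 1"] by (intro sum.neutral) auto
      finally show ?thesis .
    qed
    moreover have "\<forall>x\<in>?V. smooth (\<phi> x)" "\<forall>x\<in>?B. \<phi> x = \<psi> x"
      using sm by (auto simp: \<phi>_def)
    ultimately show ?thesis
      using tr unfolding laplacian_behavior_def by blast
  qed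
  moreover have "(\<psi>, J) \<in> terminal_behavior N"
    if lb: "(\<psi>, J) \<in> laplacian_behavior ?V ?B ?n p q ?w" for \<psi> J
  proof -
    obtain \<phi> where tr: "\<psi> \<in> trajectories ?B" "J \<in> trajectories ?B"
      and J0: "\<And>t. (\<Sum>x\<in>?B. J x t) = 0"
      and sm: "\<And>x. x \<in> ?V \<Longrightarrow> smooth (\<phi> x)" and \<phi>: "\<And>x. x \<in> ?B \<Longrightarrow> \<phi> x = \<psi> x"
      and lap: "\<And>t x. x \<in> ?V \<Longrightarrow> laplacian ?V ?w (\<lambda>y. diff_op ?n q (\<phi> y) t) x
          = (if x \<in> ?B then diff_op ?n p (J x) t else 0)"
      using lb unfolding laplacian_behavior_def by blast
    have smJ: "smooth (J x)" if "x \<in> ?B" for x by (rule trajectories_smooth[OF tr(2) that])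
    obtain r where r: "r \<in> ?V" using BV by blast
    have "\<exists>u. \<forall>y\<in>?V. laplacian ?V ?w u y = (if y = x then 1 else 0) - (if y = r then 1 else 0)"
      if "x \<in> ?V" for x
      using laplacian_solvable_and_kernel[OF G,
          of "\<lambda>y. (if y = x then 1 else 0) - (if y = r then 1 else 0)" "\<lambda>_. 0"] that r fin
      by (simp add: sum_subtractf)
    then obtain u where u: "\<And>x y. x \<in> ?V \<Longrightarrow> y \<in> ?V \<Longrightarrow>
        laplacian ?V ?w (u x) y = (if y = x then 1 else 0) - (if y = r then 1 else 0)"
      by metis
    have lap_u: "laplacian ?V ?w (\<lambda>y. \<Sum>x\<in>?B. c x * u x y) z = (if z \<in> ?B then c z else 0)"
      if c: "(\<Sum>x\<in>?B. c x) = 0" and z: "z \<in> ?V" for c z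
    proof -
      have "laplacian ?V ?w (\<lambda>y. \<Sum>x\<in>?B. c x * u x y) z
          = (\<Sum>x\<in>?B. c x * laplacian ?V ?w (u x) z)"
        unfolding laplacian_def sum_distrib_left
        by (subst sum.swap) (simp add: sum_subtractf[symmetric] sum_distrib_left algebra_simps)
      also have "\<dots> = (\<Sum>x\<in>?B. (if z = x then c x else 0) - c x * (if z = r then 1 else 0))"
        by (intro sum.cong refl, subst u) (use BV z in \<open>auto simp: algebra_simps\<close>)
      also have "\<dots> = (if z \<in> ?B then c z else 0)"
        using finite_subset[OF BV(1) fin] c
        by (simp add: sum_subtractf sum_distrib_right[symmetric])
      finally show ?thesis .
    qed
    \<comment> \<open>\<open>u x\<close> is the potential of a unit current from \<open>x\<close> to the root \<open>r\<close>; since \<open>J\<close> sums to zero,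
      superposing these potentials with weights \<open>J x\<close> cancels the terms at \<open>r\<close>.\<close>
    define C where "C k x = g k * (u x (?hd k) - u x (?tl k))" for k x
    \<comment> \<open>The coefficients \<open>C k x\<close> are constant in time, so the currents
      are smooth and \<open>diff_op\<close> passes through the sum. \<open>restrict\<close> gives
      the value \<open>undefined\<close> that \<open>trajectories\<close> demands off the index
      set.\<close>
    define I where "I = restrict (\<lambda>k t. \<Sum>x\<in>?B. C k x * J x t) {..<net_size N}"
    define U where "U = restrict (\<lambda>k t. \<phi> (?hd k) t - \<phi> (?tl k) t) {..<net_size N}"
    have trI: "I \<in> trajectories {..<net_size N}"
      unfolding I_def using smJ by (intro restrict_trajectories smooth_sum)
    have trU: "U \<in> trajectories {..<net_size N}"
      unfolding U_def using sm edge by (intro restrict_trajectories smooth_minus) auto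
    have tr\<phi>: "restrict \<phi> (?V - ?B) \<in> trajectories (?V - ?B)"
      using sm by (intro restrict_trajectories) auto
    have C: "(\<Sum>x\<in>?B. C k x * c x)
        = g k * ((\<Sum>x\<in>?B. c x * u x (?hd k)) - (\<Sum>x\<in>?B. c x * u x (?tl k)))" for k c
      by (simp add: C_def sum_subtractf[symmetric] sum_distrib_left algebra_simps)
    have kcl: "(\<Sum>k<net_size N. incidence N x k * I k t) = (if x \<in> ?B then J x t else 0)"
      if x: "x \<in> ?V" for x t
    proof -
      have "(\<Sum>k<net_size N. incidence N x k * I k t)
          = laplacian ?V ?w (\<lambda>y. \<Sum>x\<in>?B. J x t * u x y) x"
        unfolding laplacian_conductance[OF N x] I_def by (intro sum.cong) (auto simp: C)
      then show ?thesis using lap_u[OF J0 x] by simp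
    qed
    have kvl: "U k t = (\<Sum>x\<in>?B. incidence N x k * \<psi> x t)
        + (\<Sum>x\<in>?V - ?B. incidence N x k * restrict \<phi> (?V - ?B) x t)"
      if k: "k < net_size N" for k t
    proof -
      have "U k t = (\<Sum>x\<in>?V. incidence N x k * \<phi> x t)"
        using incidence_transpose[OF N k] k by (simp add: U_def)
      also have "\<dots> = (\<Sum>x\<in>?V - ?B. incidence N x k * \<phi> x t) + (\<Sum>x\<in>?B. incidence N x k * \<phi> x t)"
        by (rule sum.subset_diff[OF BV(1) fin])
      finally show ?thesis using \<phi> by simp
    qed
    have con: "diff_op ?n p (I k) t = g k * diff_op ?n q (U k) t" if k: "k < net_size N" for k t
    proof -
      \<comment> \<open>\<open>s\<close> and \<open>v\<close> have the same Laplacian, hence differ by a constant, hence have equal edge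
        differences.\<close>
      define c where "c x = diff_op ?n p (J x) t" for x
      define v where "v = (\<lambda>y. diff_op ?n q (\<phi> y) t)"
      define s where "s = (\<lambda>y. \<Sum>x\<in>?B. c x * u x y)"
      have "(\<Sum>x\<in>?B. c x) = diff_op ?n p (\<lambda>t. \<Sum>x\<in>?B. 1 * J x t) t"
        unfolding c_def using diff_op_sum[of ?B J ?n p "\<lambda>_. 1" t] smJ by simp
      then have c0: "(\<Sum>x\<in>?B. c x) = 0" using J0 by (simp add: diff_op_zero)
      have "laplacian ?V ?w (\<lambda>y. s y - v y) x = laplacian ?V ?w s x - laplacian ?V ?w v x" for x
        unfolding laplacian_def sum_subtractf[symmetric] by (intro sum.cong) (auto simp: algebra_simps)
      moreover have "laplacian ?V ?w s x = laplacian ?V ?w v x" if "x \<in> ?V" for x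
        unfolding s_def v_def lap_u[OF c0 that] lap[OF that] by (simp add: c_def)
      ultimately have "\<forall>x\<in>?V. laplacian ?V ?w (\<lambda>y. s y - v y) x = 0"
        by simp
      then have "\<forall>x\<in>?V. \<forall>y\<in>?V. s x - v x = s y - v y"
        using laplacian_solvable_and_kernel[OF G, of "\<lambda>_. 0" "\<lambda>y. s y - v y"] by blast
      then have "s (?hd k) - v (?hd k) = s (?tl k) - v (?tl k)"
        using edge[OF k] by blast
      then have eq: "s (?hd k) - s (?tl k) = v (?hd k) - v (?tl k)" by linarith
      have "diff_op ?n p (I k) t = (\<Sum>x\<in>?B. C k x * c x)"
        unfolding c_def I_def using smJ k by (simp add: diff_op_sum)
      also have "\<dots> = g k * (s (?hd k) - s (?tl k))" by (simp add: C s_def)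
      also have "\<dots> = g k * diff_op ?n q (U k) t"
        unfolding eq v_def U_def using sm edge[OF k] k by (simp add: diff_op_minus)
      finally show ?thesis .
    qed
    show ?thesis
      unfolding terminal_behavior_def
    proof (intro CollectI case_prodI conjI tr, rule bexI[OF _ tr\<phi>], rule bexI[OF _ trI],
        rule bexI[OF _ trU], rule allI, intro conjI)
      show "\<forall>x\<in>?V - ?B. (\<Sum>k<net_size N. incidence N x k * I k t) = 0" for t
        using kcl by simp
      show "\<forall>x\<in>?B. (\<Sum>k<net_size N. incidence N x k * I k t) = J x t" for t
        using kcl BV by auto
      show "\<forall>k<net_size N. U k t = (\<Sum>x\<in>?B. incidence N x k * \<psi> x t)
        + (\<Sum>x\<in>?V - ?B. incidence N x k * restrict \<phi> (?V - ?B) x t)" for t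
        using kvl by blast
      show "\<forall>k<net_size N. (\<Sum>j\<le>?n. net_P N $$ (j, k) * (deriv ^^ j) (I k) t)
          = (\<Sum>j\<le>?n. net_Q N $$ (j, k) * (deriv ^^ j) (U k) t)" for t
        using con constitutive by blast
    qed
  qed
  ultimately show ?thesis unfolding g_def by auto
qed

section \<open>Realizing a weighted graph as a network\<close>

text \<open>Bridges a mismatch on the diagonal: \<open>w\<close> may carry loops from
  \<open>star_mesh\<close>, whereas conductances of a network have none.\<close>

lemma laplacian_behavior_cong:
  assumes "\<And>x y. x \<in> V \<Longrightarrow> y \<in> V \<Longrightarrow> x \<noteq> y \<Longrightarrow> w x y = w' x y"
  shows "laplacian_behavior V B n p q w = laplacian_behavior V B n p q w'"
proof -
  have "laplacian V w u x = laplacian V w' u x" if "x \<in> V" for u x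
    unfolding laplacian_def
  proof (rule sum.cong[OF refl])
    fix y assume "y \<in> V"
    then show "w x y * (u x - u y) = w' x y * (u x - u y)"
      using assms[of x y] that by (cases "x = y") auto
  qed
  then show ?thesis unfolding laplacian_behavior_def by simp
qed

text \<open>Each pair of positive weight becomes two opposite edges, which avoids choosing an
  orientation. If \<open>B\<close> is a single vertex, the network has no edges.\<close>

lemma laplacian_behavior_realizable:
  fixes B :: "'v set"
  assumes G: "weighted_graph B w"
    and p: "\<forall>j\<le>n. p j \<ge> 0" "\<exists>j\<le>n. p j \<noteq> 0"
    and q: "\<forall>j\<le>n. q j \<ge> 0" "\<exists>j\<le>n. q j \<noteq> 0"
  shows "\<exists>N :: 'v network. generalized_network N \<and> pverts (net_graph N) = B \<and>
    net_boundary N = B \<and> net_order N = n \<and>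
    terminal_behavior N = laplacian_behavior B B n p q w"
proof -
  have fin: "finite B" and B: "B \<noteq> {}" using G by (auto simp: weighted_graph_def)
  define E where "E = {(x, y). x \<in> B \<and> y \<in> B \<and> x \<noteq> y \<and> w x y > 0}"
  have "finite E" using finite_subset[of E "B \<times> B"] fin by (auto simp: E_def)
  then obtain es where es: "distinct es" "set es = E" using finite_distinct_list by blast
  \<comment> \<open>\<open>E\<close> contains both orientations of each edge, so each carries half of the weight.\<close>
  define b where "b k = w (fst (es ! k)) (snd (es ! k)) / 2" for k
  have es_nth: "es ! k \<in> E" if "k < length es" for k using es that by auto
  have b: "b k > 0" if "k < length es" for k
    using es_nth[OF that] by (auto simp: b_def E_def split: prod.splits)
  \<comment> \<open>The factor in \<open>1 * p j\<close> exhibits the columns as multiples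
    \<open>a k * p j\<close> with \<open>a k = 1\<close>, so the conductances are
    \<open>b k / 1\<close>.\<close>
  define N :: "'v network" where "N = \<lparr>net_graph = \<lparr>pverts = B, parcs = E\<rparr>, net_edges = es,
    net_boundary = B, net_order = n, net_P = mat (n + 1) (length es) (\<lambda>(j, k). 1 * p j),
    net_Q = mat (n + 1) (length es) (\<lambda>(j, k). b k * q j)\<rparr>"
  have wf: "pair_digraph (net_graph N)"
    using fin \<open>finite E\<close> by unfold_locales (auto simp: N_def E_def)
  then have wf': "pair_wf_digraph (net_graph N)"
    by (simp add: pair_digraph_def pair_fin_digraph_def)
  have "\<exists>x\<in>S. \<exists>y\<in>B - S. (x, y) \<in> E \<or> (y, x) \<in> E" if S: "S \<subseteq> B" "S \<noteq> {}" "S \<noteq> B" for S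
  proof -
    obtain x y where "x \<in> S" "y \<in> B - S" "w x y > 0"
      using G S unfolding weighted_graph_def by blast
    then show ?thesis using S unfolding E_def by blast
  qed
  then have conn: "Digraph_Component.connected (with_proj (net_graph N))"
    using B unfolding connected_iff_cut[OF wf'] by (simp add: N_def)
  have col: "col (mat (n + 1) (length es) (\<lambda>(j, k). c k * f j)) k \<noteq> 0\<^sub>v (n + 1)"
    if k: "k < length es" and "c k > 0" and f: "\<exists>j\<le>n. f j \<noteq> 0" for c f :: "nat \<Rightarrow> real" and k
  proof
    assume eq: "col (mat (n + 1) (length es) (\<lambda>(j, k). c k * f j)) k = 0\<^sub>v (n + 1)"
    obtain j where j: "j \<le> n" "f j \<noteq> 0" using f by blast
    have "col (mat (n + 1) (length es) (\<lambda>(j, k). c k * f j)) k $ j = 0"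
      unfolding eq using j by simp
    then show False using j k \<open>c k > 0\<close> by simp
  qed
  have N: "generalized_network N"
    unfolding generalized_network_def
  proof (intro conjI wf conn allI impI)
    fix k j assume k: "k < net_size N"
    show "net_P N $$ (j, k) \<ge> 0" "net_Q N $$ (j, k) \<ge> 0" if "j \<le> net_order N"
      using k that p(1) q(1) b[of k] by (simp_all add: N_def)
    show "col (net_P N) k \<noteq> 0\<^sub>v (net_order N + 1)"
      using col[of k "\<lambda>_. 1" p] p k by (simp add: N_def)
    show "col (net_Q N) k \<noteq> 0\<^sub>v (net_order N + 1)"
      using col[of k b q] q b k by (simp add: N_def)
  qed (use es B in \<open>simp_all add: N_def\<close>)
  have "conductance es b x y = w x y" if xy: "x \<in> B" "y \<in> B" "x \<noteq> y" for x y
  proof -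
    \<comment> \<open>The summand is written as a function of \<open>es ! k\<close>, so that the sum
      over positions can be reindexed as a sum over \<open>E\<close>.\<close>
    have "conductance es b x y
        = (\<Sum>k<length es. (\<lambda>e. if e = (x, y) \<or> e = (y, x) then w (fst e) (snd e) / 2 else 0) (es ! k))"
      by (auto simp: conductance_def b_def intro!: sum.cong)
    also have "\<dots> = (\<Sum>e\<in>E. if e = (x, y) \<or> e = (y, x) then w (fst e) (snd e) / 2 else 0)"
      using bij_betw_nth[OF es(1) refl] es(2) by (intro sum.reindex_bij_betw) auto
    also have "\<dots> = (\<Sum>e\<in>E. (if e = (x, y) then w x y / 2 else 0) + (if e = (y, x) then w y x / 2 else 0))"
      using xy by (intro sum.cong) auto
    \<comment> \<open>If \<open>w x y\<close> is positive, both orientations lie in \<open>E\<close>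
      and the halves add up by symmetry; otherwise it is zero and neither lies in
      \<open>E\<close>.\<close>
    also have "\<dots> = w x y"
      using \<open>finite E\<close> G xy by (simp add: sum.distrib E_def weighted_graph_def)
        (metis less_eq_real_def)
    finally show ?thesis .
  qed
  then have "laplacian_behavior B B n p q (conductance es (\<lambda>k. b k / 1)) = laplacian_behavior B B n p q w"
    by (intro laplacian_behavior_cong) simp
  moreover have "terminal_behavior N = laplacian_behavior (pverts (net_graph N)) (net_boundary N)
      (net_order N) p q (conductance (net_edges N) (\<lambda>k. b k / 1))"
    using b by (intro terminal_behavior_eq_laplacian_behavior[OF N]) (simp_all add: N_def)
  ultimately show ?thesis
    using N by (intro exI[of _ N]) (simp add: N_def)
qed

section \<open>Nonnegative matrices of rank one\<close>

text \<open>Otherwise columns \<open>i\<close> and \<open>k\<close> would be linearly independent,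
  and the rank would be at least two.\<close>

lemma cols_proportional:
  fixes A :: "real mat"
  assumes A: "A \<in> carrier_mat n m" and dim: "vec_space.dim_span n (set (cols A)) = 1"
    and i: "i < m" "col A i \<noteq> 0\<^sub>v n" and k: "k < m"
  shows "\<exists>c. \<forall>j<n. A $$ (j, k) = c * A $$ (j, i)"
proof (rule ccontr)
  assume no: "\<not> ?thesis"
  interpret vec_space "TYPE(real)" n .
  let ?v = "col A i" and ?u = "col A k"
  have cols: "{?v, ?u} \<subseteq> set (cols A)" using A i k by (auto simp: cols_def)
  have carr: "{?v, ?u} \<subseteq> carrier_vec n" using A by auto
  have vj: "?v $ j = A $$ (j, i)" "?u $ j = A $$ (j, k)" if "j < n" for j
    using that A i k by auto
  \<comment> \<open>Distinctness makes the set of the two columns have cardinality two, as the rank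
    bound requires.\<close>
  have ne: "?u \<noteq> ?v"
  proof
    assume "?u = ?v"
    then have "A $$ (j, k) = 1 * A $$ (j, i)" if "j < n" for j using vj[OF that] by simp
    then show False using no by blast
  qed
  have "lin_indpt {?v, ?u}"
  proof (rule finite_lin_indpt2)
    fix a assume "lincomb a {?v, ?u} = 0\<^sub>v n"
    then have comb: "a ?v * ?v $ j + a ?u * ?u $ j = 0" if "j < n" for j
      using lincomb_index[OF that carr, of a] that ne by simp
    have au: "a ?u = 0"
    proof (rule ccontr)
      assume "a ?u \<noteq> 0"
      then have "A $$ (j, k) = (- a ?v / a ?u) * A $$ (j, i)" if "j < n" for j
        using comb[OF that] vj[OF that] by (simp add: field_simps)
      then show False using no by blast
    qed
    obtain j where "j < n" "?v $ j \<noteq> 0" using i A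
      by (metis carrier_matD(1) dim_col eq_vecI index_zero_vec(1) index_zero_vec(2))
    then have "a ?v = 0" using comb au by force
    then show "\<forall>v\<in>{?v, ?u}. a v = 0" using au by simp
  qed (use carr in auto)
  then have "card {?v, ?u} \<le> rank A" by (rule rank_ge_card_indpt[OF A cols])
  then show False using ne dim by (simp add: rank_def dim_span_def)
qed

text \<open>Column 0 serves as the common direction. Comparing a nonzero entry of column
  \<open>k\<close> with the nonnegative entry of column 0 in the same row shows that the factor is
  positive.\<close>

lemma cols_positive_multiples:
  fixes A :: "real mat"
  assumes A: "A \<in> carrier_mat (n + 1) m" and dim: "vec_space.dim_span (n + 1) (set (cols A)) = 1"
    and nn: "\<forall>j\<le>n. \<forall>k<m. A $$ (j, k) \<ge> 0" and nz: "\<forall>k<m. col A k \<noteq> 0\<^sub>v (n + 1)"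
  shows "\<exists>p c. (\<forall>j\<le>n. p j \<ge> 0) \<and> (\<exists>j\<le>n. p j \<noteq> 0) \<and> (\<forall>k<m. c k > 0) \<and>
    (\<forall>j\<le>n. \<forall>k<m. A $$ (j, k) = c k * p j)"
proof -
  have entry: "\<exists>j\<le>n. A $$ (j, k) \<noteq> 0" if "k < m" for k
  proof (rule ccontr)
    assume "\<not> ?thesis"
    then have "col A k = 0\<^sub>v (n + 1)" using A that by (intro eq_vecI) auto
    then show False using nz that by blast
  qed
  \<comment> \<open>Without columns the span is the zero space, of dimension 0 instead of 1.\<close>
  have "m \<noteq> 0"
  proof
    interpret vec_space "TYPE(real)" "n + 1" .
    assume "m = 0"
    then have "set (cols A) = {}" using A by (simp add: cols_def)
    then show False using dim dim_zero_vs unfolding dim_span_def by simp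
  qed
  then have m: "0 < m" by simp
  define p where "p j = A $$ (j, 0)" for j
  have "\<forall>k. \<exists>c. k < m \<longrightarrow> (\<forall>j<n + 1. A $$ (j, k) = c * A $$ (j, 0))"
    using cols_proportional[OF A dim m nz[rule_format, OF m]] by blast
  then obtain c where c: "\<And>j k. j \<le> n \<Longrightarrow> k < m \<Longrightarrow> A $$ (j, k) = c k * p j"
    unfolding p_def by (metis Suc_eq_plus1 less_Suc_eq_le)
  have p: "p j \<ge> 0" if "j \<le> n" for j using nn m that by (simp add: p_def)
  have "c k > 0" if k: "k < m" for k
  proof -
    obtain j where j: "j \<le> n" "A $$ (j, k) \<noteq> 0" using entry[OF k] by blast
    moreover have "A $$ (j, k) \<ge> 0" using nn j k by blast
    ultimately have "c k * p j \<ge> 0" "c k * p j \<noteq> 0" unfolding c[OF j(1) k] by simp_all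
    then have "c k * p j > 0" by linarith
    then show ?thesis using p[OF j(1)] by (simp add: zero_less_mult_iff)
  qed
  moreover have "\<exists>j\<le>n. p j \<noteq> 0" using entry[OF m] by (simp add: p_def)
  ultimately show ?thesis using p c by blast
qed

theorem theorem4p4:
  fixes N :: "'v network"
  assumes "generalized_network N"
    and "vec_space.dim_span (net_order N + 1) (set (cols (net_P N))) = 1"
    and "vec_space.dim_span (net_order N + 1) (set (cols (net_Q N))) = 1"
  shows "\<exists>N' :: 'v network.
    generalized_network N' \<and>
    pverts (net_graph N') = net_boundary N \<and>
    net_boundary N' = net_boundary N \<and>
    net_order N' = net_order N \<and>
    terminal_behavior N = terminal_behavior N'"
proof -
  note N = assms(1)
  have PQ: "net_P N \<in> carrier_mat (net_order N + 1) (net_size N)"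
      "net_Q N \<in> carrier_mat (net_order N + 1) (net_size N)"
    and nn: "\<forall>j\<le>net_order N. \<forall>k<net_size N. net_P N $$ (j, k) \<ge> 0"
      "\<forall>j\<le>net_order N. \<forall>k<net_size N. net_Q N $$ (j, k) \<ge> 0"
    and nz: "\<forall>k<net_size N. col (net_P N) k \<noteq> 0\<^sub>v (net_order N + 1)"
      "\<forall>k<net_size N. col (net_Q N) k \<noteq> 0\<^sub>v (net_order N + 1)"
    and B: "net_boundary N \<subseteq> pverts (net_graph N)" "net_boundary N \<noteq> {}"
    using N unfolding generalized_network_def by auto
  obtain p a where p: "\<forall>j\<le>net_order N. p j \<ge> 0" "\<exists>j\<le>net_order N. p j \<noteq> 0"
    and a: "\<forall>k<net_size N. a k > 0"
      "\<forall>j\<le>net_order N. \<forall>k<net_size N. net_P N $$ (j, k) = a k * p j"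
    using cols_positive_multiples[OF PQ(1) assms(2) nn(1) nz(1)] by blast
  obtain q b where q: "\<forall>j\<le>net_order N. q j \<ge> 0" "\<exists>j\<le>net_order N. q j \<noteq> 0"
    and b: "\<forall>k<net_size N. b k > 0"
      "\<forall>j\<le>net_order N. \<forall>k<net_size N. net_Q N $$ (j, k) = b k * q j"
    using cols_positive_multiples[OF PQ(2) assms(3) nn(2) nz(2)] by blast
  let ?w = "conductance (net_edges N) (\<lambda>k. b k / a k)"
  have "weighted_graph (pverts (net_graph N)) ?w"
    using a b by (intro weighted_graph_conductance[OF N]) simp
  then obtain w where w: "weighted_graph (net_boundary N) w"
    "laplacian_behavior (pverts (net_graph N)) (net_boundary N) (net_order N) p q ?w
      = laplacian_behavior (net_boundary N) (net_boundary N) (net_order N) p q w"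
    using laplacian_behavior_boundary[OF _ B] by blast
  obtain N' :: "'v network" where "generalized_network N'"
      "pverts (net_graph N') = net_boundary N" "net_boundary N' = net_boundary N"
      "net_order N' = net_order N"
      "terminal_behavior N' = laplacian_behavior (net_boundary N) (net_boundary N) (net_order N) p q w"
    using laplacian_behavior_realizable[OF w(1) p q] by blast
  then show ?thesis
    using terminal_behavior_eq_laplacian_behavior[OF N a(2) b(2) a(1) b(1)] w(2) by auto
qed

end
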